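(* Let $k\in\mathbb{N}$. Every edge-coloured graph $G$ on $n \ge 7k/2+2$ vertices with $\delta^c(G) \geq k$ contains a rainbow matching of size $k$.
   Context: Graphs are simple (no loops or multiple edges). An edge-coloured graph is a graph in which each edge is assigned a colour (not necessarily properly). A subgraph is rainbow if all its edges have distinct colours. For a vertex $v$, the colour degree $d^c(v)$ is the number of distinct colours on the edges incident with $v$; $\delta^c(G)=\min_{v\in V(G)} d^c(v)$ is the minimum colour degree. *)

theory Defs
  imports Complex_Main
begin

locale finite_simple_graph =
  fixes V :: "'a set" and E :: "'a set set"
  assumes finite_vertices: "finite V"
    and edges_wf: "e \<in> E \<Longrightarrow> e \<subseteq> V \<and> card e = 2"

text \<open>
  An edge colouring is an arbitrary function \<open>c :: 'a set \<Rightarrow> 'c\<close>, not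
  necessarily proper; only its values on \<open>E\<close> are ever used.
\<close>

definition colour_degree :: "'a set set \<Rightarrow> ('a set \<Rightarrow> 'c) \<Rightarrow> 'a \<Rightarrow> nat" where
  "colour_degree E c v = card (c ` {e \<in> E. v \<in> e})"

text \<open>Meaningful only for finite nonempty \<open>V\<close>, as usual for \<^const>\<open>Min\<close>.\<close>

definition min_colour_degree :: "'a set \<Rightarrow> 'a set set \<Rightarrow> ('a set \<Rightarrow> 'c) \<Rightarrow> nat" where
  "min_colour_degree V E c = Min (colour_degree E c ` V)"

definition matching :: "'a set set \<Rightarrow> 'a set set \<Rightarrow> bool" where
  "matching E M \<longleftrightarrow> M \<subseteq> E \<and> pairwise disjnt M"

definition rainbow :: "('a set \<Rightarrow> 'c) \<Rightarrow> 'a set set \<Rightarrow> bool" where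
  "rainbow c M \<longleftrightarrow> inj_on c M"

end

theory Submission
  imports Defs
begin

text \<open>
  Delete edges until no further one can be deleted without some colour degree dropping below \<open>k\<close>,
  and suppose that the largest rainbow matchings have \<open>m < k\<close> edges. Such a matching is
  represented by three vertex-disjoint and colour-disjoint parts: a \<^emph>\<open>core\<close> \<open>(U, C)\<close>, inside which the
  colours \<open>C\<close> can be matched while avoiding any prescribed vertex; a rainbow matching \<open>M\<close>; and
  disjoint \<^emph>\<open>cherries\<close> (paths with two edges) which, read as edges between their two colours, form a
  forest, so that the cherries can be matched while omitting one colour from each tree. Choose such a
  configuration with \<open>card C\<close> and then the number \<open>r\<close> of cherries maximal, subject to
  \<open>2 * card U \<le> 7 * card C\<close>.

  Each of the \<open>p\<close> vertices outside the configuration sends at least \<open>r + 1\<close> colours not in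
  \<open>C \<union> c ` M\<close>, and all of these go to cherries, while a cherry receives at most \<open>p\<close> colours in total,
  or \<open>p + 1\<close> if it is of a special type. Hence at least \<open>p\<close> cherries are special. Two special
  cherries whose repeated colours are not linked once the two cherries are removed would yield a core
  with two colours on seven vertices. It follows that the special cherries occupy \<open>2p\<close> distinct colours
  in a single tree, so \<open>2p \<le> r + 1\<close>, whereas counting vertices gives \<open>2p \<ge> r + 11\<close>.
\<close>

section \<open>Forests of edges between colours\<close>

text \<open>Connectivity in the multigraph on the colours in which the index \<open>j\<close> is an
  edge joining \<open>a j\<close> and \<open>b j\<close>.\<close>

definition linked :: "('i \<Rightarrow> 'c) \<Rightarrow> ('i \<Rightarrow> 'c) \<Rightarrow> 'i set \<Rightarrow> 'c \<Rightarrow> 'c \<Rightarrow> bool" where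
  "linked a b J = (\<lambda>u v. \<exists>j\<in>J. u = a j \<and> v = b j \<or> u = b j \<and> v = a j)\<^sup>*\<^sup>*"

definition unlinked :: "('i \<Rightarrow> 'c) \<Rightarrow> ('i \<Rightarrow> 'c) \<Rightarrow> 'i set \<Rightarrow> 'c set \<Rightarrow> bool" where
  "unlinked a b J R \<longleftrightarrow> pairwise (\<lambda>u v. \<not> linked a b J u v) R"

text \<open>Acyclicity in the form that every edge is a bridge; this rules out loops and parallel
  edges as well.\<close>

definition forest :: "('i \<Rightarrow> 'c) \<Rightarrow> ('i \<Rightarrow> 'c) \<Rightarrow> 'i set \<Rightarrow> bool" where
  "forest a b I \<longleftrightarrow> (\<forall>i\<in>I. \<not> linked a b (I - {i}) (a i) (b i))"

lemma linked_refl [simp]: "linked a b J u u"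
  by (simp add: linked_def)

lemma linked_trans [trans]: "linked a b J u v \<Longrightarrow> linked a b J v w \<Longrightarrow> linked a b J u w"
  by (simp add: linked_def)

lemma linked_sym: "linked a b J u v \<Longrightarrow> linked a b J v u"
  unfolding linked_def
  by (rule sympD[OF symp_rtranclp]) (auto simp: symp_def)

lemma linked_mono: "linked a b J u v \<Longrightarrow> J \<subseteq> J' \<Longrightarrow> linked a b J' u v"
  unfolding linked_def by (erule rtranclp_mono[THEN predicate2D, rotated]) blast

lemma linked_edge: "j \<in> J \<Longrightarrow> linked a b J (a j) (b j)"
  unfolding linked_def by blast

lemma linked_insert:
  assumes "linked a b (insert j J) u v"
  shows "linked a b J u v \<or> linked a b J u (a j) \<and> linked a b J (b j) v
    \<or> linked a b J u (b j) \<and> linked a b J (a j) v"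
  using assms unfolding linked_def[of _ _ "insert j J"]
proof (induction rule: rtranclp_induct)
  case base
  then show ?case by simp
next
  case (step v w)
  from step.hyps(2) consider (1) "v = a j" "w = b j" | (2) "v = b j" "w = a j" | (3) "linked a b J v w"
    unfolding linked_def by blast
  then show ?case
    using step.IH by cases (auto intro: linked_trans)
qed

lemma linked_endpoint:
  assumes "linked a b J u v" "u \<noteq> v"
  shows "u \<in> a ` J \<union> b ` J"
  using assms(1) unfolding linked_def by (rule converse_rtranclpE) (use assms(2) in auto)

text \<open>\<open>J'\<close> is the edge set of a path from \<open>u\<close> to \<open>v\<close>.
  The last two clauses, that each edge separates and is crossed in some direction, replace an
  explicit notion of path.\<close>

lemma minimal_link:
  assumes "finite J" "linked a b J u v"
  obtains J' where "J' \<subseteq> J" "linked a b J' u v"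
    "\<And>j. j \<in> J' \<Longrightarrow> \<not> linked a b (J' - {j}) u v"
    "\<And>j. j \<in> J' \<Longrightarrow> linked a b (J' - {j}) u (a j) \<and> linked a b (J' - {j}) (b j) v
      \<or> linked a b (J' - {j}) u (b j) \<and> linked a b (J' - {j}) (a j) v"
proof -
  have "finite {J'. J' \<subseteq> J \<and> linked a b J' u v}"
    using assms(1) by simp
  moreover have "{J'. J' \<subseteq> J \<and> linked a b J' u v} \<noteq> {}"
    using assms(2) by blast
  ultimately obtain J' where J': "J' \<in> {J'. J' \<subseteq> J \<and> linked a b J' u v}"
    and min: "\<And>K. K \<in> {J'. J' \<subseteq> J \<and> linked a b J' u v} \<Longrightarrow> K \<subseteq> J' \<Longrightarrow> J' = K"
    by (metis (lifting) finite_has_minimal)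
  have cut: "\<not> linked a b (J' - {j}) u v" if "j \<in> J'" for j
    using min[of "J' - {j}"] J' that by auto
  show ?thesis
  proof (rule that[of J'])
    show "linked a b (J' - {j}) u (a j) \<and> linked a b (J' - {j}) (b j) v
      \<or> linked a b (J' - {j}) u (b j) \<and> linked a b (J' - {j}) (a j) v" if "j \<in> J'" for j
      using linked_insert[of a b j "J' - {j}" u v] cut[OF that] J' that by (auto simp: insert_absorb)
  qed (use J' cut in auto)
qed

lemma unlinkedD: "unlinked a b J R \<Longrightarrow> linked a b J u v \<Longrightarrow> u \<in> R \<Longrightarrow> v \<in> R \<Longrightarrow> u = v"
  unfolding unlinked_def pairwise_def by blast

lemma unlinked_mono: "unlinked a b J R \<Longrightarrow> J' \<subseteq> J \<Longrightarrow> unlinked a b J' R"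
  unfolding unlinked_def pairwise_def by (meson linked_mono)

lemma unlinked_pair: "\<not> linked a b J u v \<Longrightarrow> unlinked a b J {u, v}"
  using linked_sym[of a b J v u] unfolding unlinked_def pairwise_insert by auto

lemma unlinked_singleton [simp]: "unlinked a b J {u}" "unlinked a b J {}"
  unfolding unlinked_def pairwise_def by auto

lemma forest_subset: "forest a b I \<Longrightarrow> J \<subseteq> I \<Longrightarrow> forest a b J"
  unfolding forest_def by (meson Diff_mono linked_mono order_refl subsetD)

text \<open>Orient every edge of the forest away from the roots \<open>R\<close>.\<close>

lemma forest_representatives:
  assumes "finite I" "forest a b I" "unlinked a b I R"
  obtains \<phi> where "inj_on \<phi> I" "\<phi> ` I \<inter> R = {}" "\<And>i. i \<in> I \<Longrightarrow> \<phi> i = a i \<or> \<phi> i = b i"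
proof -
  have "\<exists>\<phi>. inj_on \<phi> I \<and> \<phi> ` I \<inter> R = {} \<and> (\<forall>i\<in>I. \<phi> i = a i \<or> \<phi> i = b i)"
    using assms
  proof (induction I arbitrary: R)
    case empty
    then show ?case by simp
  next
    case (insert i I)
    have for_I: "forest a b I"
      using insert.prems(1) forest_subset by blast
    have not_ab: "\<not> linked a b I (a i) (b i)"
      using insert.prems(1) insert.hyps(2) unfolding forest_def by auto
    have unl: "unlinked a b I R"
      using insert.prems(2) unlinked_mono by blast
    \<comment> \<open>Not both ends of \<open>i\<close> are linked to roots: two different roots
      would be linked through \<open>i\<close>, and a common root would close a cycle with
      \<open>i\<close>.\<close>
    obtain g where g: "g = a i \<or> g = b i" and far: "\<And>r. r \<in> R \<Longrightarrow> \<not> linked a b I r g"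
    proof (cases "\<exists>r\<in>R. linked a b I r (b i)")
      case True
      then obtain r where r: "r \<in> R" "linked a b I r (b i)" by blast
      have "\<not> linked a b I s (a i)" if s: "s \<in> R" for s
      proof
        assume *: "linked a b I s (a i)"
        have "linked a b (insert i I) s (a i)" "linked a b (insert i I) (b i) r"
          using * r(2) by (simp_all add: linked_sym linked_mono[OF _ subset_insertI])
        moreover have "linked a b (insert i I) (a i) (b i)"
          by (simp add: linked_edge)
        ultimately have "s = r"
          using unlinkedD[OF insert.prems(2) _ s r(1)] by (meson linked_trans)
        then show False
          using * r(2) not_ab by (meson linked_sym linked_trans)
      qed
      then show thesis using that by blast
    next
      case False
      then show thesis using that by blast
    qed
    \<comment> \<open>The chosen end becomes a root, so that the representatives of the other edges
      avoid it.\<close>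
    have "unlinked a b I (insert g R)"
      using unl far linked_sym[of a b I g] unfolding unlinked_def pairwise_insert by blast
    from insert.IH[OF for_I this] obtain \<phi> where \<phi>: "inj_on \<phi> I" "\<phi> ` I \<inter> insert g R = {}" "\<forall>i\<in>I. \<phi> i = a i \<or> \<phi> i = b i"
      by (elim exE conjE)
    have "g \<notin> R" using far[of g] by auto
    have upd: "(\<phi>(i := g)) j = \<phi> j" if "j \<in> I" for j
      using that insert.hyps(2) by auto
    then have im: "\<phi>(i := g) ` I = \<phi> ` I" by (rule image_cong[OF refl])
    show ?case
    proof (intro exI conjI ballI)
      have "inj_on (\<phi>(i := g)) I"
        using \<phi>(1) upd by (metis inj_on_cong)
      then show "inj_on (\<phi>(i := g)) (insert i I)"
        using \<phi>(2) im insert.hyps(2) by simp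
      show "\<phi>(i := g) ` insert i I \<inter> R = {}"
        using \<phi>(2) im \<open>g \<notin> R\<close> by auto
      show "(\<phi>(i := g)) j = a j \<or> (\<phi>(i := g)) j = b j" if "j \<in> insert i I" for j
        using that \<phi>(3) g upd by auto
    qed
  qed
  then show ?thesis using that by blast
qed

text \<open>An edge merges at most two components and so costs at most one representative; the one
  dropped is linked to \<open>a j\<close>.\<close>

lemma large_unlinked_subset:
  assumes "finite J" "finite S"
  shows "\<exists>T\<subseteq>S. card S \<le> card T + card J \<and> unlinked a b J T"
  using assms(1)
proof (induction J)
  case empty
  have "unlinked a b {} S"
    unfolding unlinked_def pairwise_def using linked_endpoint[of a b "{}"] by auto
  then show ?case by auto
next
  case (insert j J)
  then obtain T where T: "T \<subseteq> S" "card S \<le> card T + card J" "unlinked a b J T" by blast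
  have fin: "finite T" using T(1) assms(2) finite_subset by blast
  define T' where "T' = {t \<in> T. \<not> linked a b J t (a j)}"
  have one: "t = t'" if "t \<in> T - T'" "t' \<in> T - T'" for t t'
    using that unlinkedD[OF T(3) linked_trans[OF _ linked_sym], of t "a j" t'] unfolding T'_def by simp
  have "card (T - T') \<le> 1"
    using one fin by (auto simp: card_le_Suc0_iff_eq)
  then have "card T \<le> card T' + 1"
    using fin card_Diff_subset[of T' T] unfolding T'_def by (simp add: finite_subset)
  moreover have "unlinked a b (insert j J) T'"
    unfolding unlinked_def pairwise_def
  proof (intro ballI impI notI)
    fix u v assume uv: "u \<in> T'" "v \<in> T'" "u \<noteq> v" "linked a b (insert j J) u v"
    then have "\<not> linked a b J u v"
      using unlinkedD[OF T(3)] unfolding T'_def by auto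
    then show False
      using linked_insert[OF uv(4)] uv(1,2) linked_sym[of a b J "a j" v] unfolding T'_def by blast
  qed
  ultimately show ?case
    using T insert.hyps unfolding T'_def by (intro exI[of _ T']) (auto simp: T'_def)
qed

text \<open>An unlinked subset of \<open>S\<close> has at most one element here. This is the usual
  bound on the vertices of a connected graph by its edges.\<close>

lemma linked_card_le:
  assumes "finite J" "finite S" "\<And>u v. u \<in> S \<Longrightarrow> v \<in> S \<Longrightarrow> linked a b J u v"
  shows "card S \<le> card J + 1"
proof -
  obtain T where T: "T \<subseteq> S" "card S \<le> card T + card J" "unlinked a b J T"
    using large_unlinked_subset[OF assms(1,2)] by blast
  have "finite T" using T(1) assms(2) finite_subset by blast
  then have "card T \<le> 1"
    using unlinkedD[OF T(3)] assms(3) T(1) by (auto simp: card_le_Suc0_iff_eq subset_iff)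
  then show ?thesis using T(2) by simp
qed

text \<open>Two edge-disjoint links form a cycle: an edge of a minimal link inside \<open>J\<close>
  is bypassed by the rest of that link and the link outside \<open>J\<close>.\<close>

lemma forest_no_second_link:
  assumes "finite I" "forest a b I" "J \<subseteq> I" "linked a b J u v" "linked a b (I - J) u v"
  shows "u = v"
proof (rule ccontr)
  assume ne: "u \<noteq> v"
  obtain J' where J': "J' \<subseteq> J" "linked a b J' u v"
    "\<And>j. j \<in> J' \<Longrightarrow> linked a b (J' - {j}) u (a j) \<and> linked a b (J' - {j}) (b j) v
      \<or> linked a b (J' - {j}) u (b j) \<and> linked a b (J' - {j}) (a j) v"
    using minimal_link[OF finite_subset[OF assms(3,1)] assms(4)] by metis
  obtain j where j: "j \<in> J'"
    using linked_endpoint[OF J'(2) ne] by auto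
  have sub: "linked a b (I - {j}) s t" if "linked a b (J' - {j}) s t" for s t
    using that by (rule linked_mono) (use J'(1) assms(3) in auto)
  have "linked a b (I - {j}) u v"
    using assms(5) by (rule linked_mono) (use J'(1) j in auto)
  then have "linked a b (I - {j}) (a j) (b j)"
    using J'(3)[OF j] by (meson linked_sym linked_trans sub)
  then show False
    using assms(2,3) J'(1) j unfolding forest_def by auto
qed

section \<open>Cores, cherries and configurations\<close>

locale edge_coloured_graph = finite_simple_graph V E
  for V :: "'a set" and E :: "'a set set" +
  fixes c :: "'a set \<Rightarrow> 'c"
begin

definition rainbow_matching :: "'a set set \<Rightarrow> bool" where
  "rainbow_matching N \<longleftrightarrow> matching E N \<and> rainbow c N"

lemma finite_E: "finite E"
  using edges_wf finite_vertices by (metis Pow_iff finite_Pow_iff finite_subset subsetI)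

lemma edge_subset: "e \<in> E \<Longrightarrow> e \<subseteq> V"
  and card_edge: "e \<in> E \<Longrightarrow> card e = 2"
  using edges_wf by auto

lemma edge_ne: "{u, v} \<in> E \<Longrightarrow> u \<noteq> v"
  using card_edge by fastforce

lemma edge_other_end:
  assumes "e \<in> E" "u \<in> e"
  obtains v where "e = {v, u}"
proof -
  obtain a b where "e = {a, b}" using card_edge[OF assms(1)] unfolding card_2_iff by metis
  then have "e = {a, u} \<or> e = {b, u}" using assms(2) by auto
  then show thesis using that by metis
qed

lemma rainbow_matching_subset_E: "rainbow_matching N \<Longrightarrow> N \<subseteq> E"
  unfolding rainbow_matching_def matching_def by simp

lemma rainbow_matching_subset: "rainbow_matching N \<Longrightarrow> N' \<subseteq> N \<Longrightarrow> rainbow_matching N'"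
  unfolding rainbow_matching_def matching_def rainbow_def by (meson inj_on_subset order_trans pairwise_subset)

lemma rainbow_matching_finite: "rainbow_matching N \<Longrightarrow> finite N"
  using rainbow_matching_subset_E finite_E finite_subset by blast

lemma rainbow_matching_card_image: "rainbow_matching N \<Longrightarrow> card (c ` N) = card N"
  unfolding rainbow_matching_def rainbow_def by (auto intro: card_image)

lemma rainbow_matching_empty [simp]: "rainbow_matching {}"
  unfolding rainbow_matching_def matching_def rainbow_def by simp

lemma rainbow_matching_single [simp]: "rainbow_matching {e} \<longleftrightarrow> e \<in> E"
  unfolding rainbow_matching_def matching_def rainbow_def by simp

lemma rainbow_matching_pair:
  "e \<in> E \<Longrightarrow> e' \<in> E \<Longrightarrow> e \<inter> e' = {} \<Longrightarrow> c e \<noteq> c e' \<Longrightarrow> rainbow_matching {e, e'}"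
  unfolding rainbow_matching_def matching_def rainbow_def by (auto simp: pairwise_insert disjnt_def)

lemma rainbow_matching_Un:
  assumes "rainbow_matching N" "rainbow_matching N'" "\<Union>N \<inter> \<Union>N' = {}" "c ` N \<inter> c ` N' = {}"
  shows "rainbow_matching (N \<union> N')" "card (N \<union> N') = card N + card N'"
proof -
  have "disjnt e e'" if "e \<in> N" "e' \<in> N'" for e e'
    using assms(3) that unfolding disjnt_def by blast
  then have "pairwise disjnt (N \<union> N')"
    using assms(1,2) unfolding rainbow_matching_def matching_def pairwise_def
    by (metis Un_iff disjnt_sym)
  moreover have "inj_on c (N \<union> N')"
    using assms(1,2,4) unfolding rainbow_matching_def rainbow_def inj_on_def by blast
  ultimately show "rainbow_matching (N \<union> N')"
    using assms(1,2) unfolding rainbow_matching_def matching_def rainbow_def by blast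
  have "N \<inter> N' = {}" using assms(4) by blast
  then show "card (N \<union> N') = card N + card N'"
    using card_Un_disjoint assms(1,2)[THEN rainbow_matching_finite] by auto
qed

text \<open>A core can always give up one of its vertices without losing a colour.\<close>

definition core :: "'a set \<Rightarrow> 'c set \<Rightarrow> bool" where
  "core U C \<longleftrightarrow> (\<forall>u. \<exists>N. rainbow_matching N \<and> \<Union>N \<subseteq> U - {u} \<and> c ` N = C)"

lemma coreE:
  assumes "core U C"
  obtains N where "rainbow_matching N" "\<Union>N \<subseteq> U" "u \<notin> \<Union>N" "c ` N = C"
  using assms[unfolded core_def, THEN spec, of u] that by auto

lemma core_finite: "core U C \<Longrightarrow> finite C"
  by (metis coreE finite_imageI rainbow_matching_finite)

lemma core_Un:
  assumes "core U C" "core U' C'" "U \<inter> U' = {}" "C \<inter> C' = {}"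
  shows "core (U \<union> U') (C \<union> C')"
  unfolding core_def
proof
  fix u
  obtain N where N: "rainbow_matching N" "\<Union>N \<subseteq> U" "u \<notin> \<Union>N" "c ` N = C"
    using coreE[OF assms(1)] by metis
  obtain N' where N': "rainbow_matching N'" "\<Union>N' \<subseteq> U'" "u \<notin> \<Union>N'" "c ` N' = C'"
    using coreE[OF assms(2)] by metis
  have "rainbow_matching (N \<union> N')"
    by (rule rainbow_matching_Un(1)[OF N(1) N'(1)]) (use N N' assms(3,4) in blast)+
  then show "\<exists>N. rainbow_matching N \<and> \<Union>N \<subseteq> U \<union> U' - {u} \<and> c ` N = C \<union> C'"
    using N N' by (intro exI[of _ "N \<union> N'"]) (auto simp: image_Un)
qed

text \<open>A triple \<open>(x, y, z)\<close> stands for the cherry with centre \<open>x\<close> and leaves \<open>y\<close>, \<open>z\<close>;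
  it is regarded as an edge joining its two colours.\<close>

definition verts :: "'a \<times> 'a \<times> 'a \<Rightarrow> 'a set" where
  "verts i = {fst i, fst (snd i), snd (snd i)}"

definition lcol :: "'a \<times> 'a \<times> 'a \<Rightarrow> 'c" where
  "lcol i = c {fst i, fst (snd i)}"

definition rcol :: "'a \<times> 'a \<times> 'a \<Rightarrow> 'c" where
  "rcol i = c {fst i, snd (snd i)}"

definition cherry_forest :: "('a \<times> 'a \<times> 'a) set \<Rightarrow> bool" where
  "cherry_forest I \<longleftrightarrow> finite I \<and> (\<forall>i\<in>I. {fst i, fst (snd i)} \<in> E \<and> {fst i, snd (snd i)} \<in> E) \<and>
    pairwise (\<lambda>i j. disjnt (verts i) (verts j)) I \<and> forest lcol rcol I"

text \<open>\<open>M\<close> together with one suitable edge from each cherry of \<open>I\<close> and a matching inside the core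
  \<open>(U, C)\<close> is a rainbow matching of size \<open>m\<close>. The bound on \<open>card U\<close> is where the factor \<open>7/2\<close> comes from.\<close>

definition config :: "nat \<Rightarrow> 'a set \<Rightarrow> 'c set \<Rightarrow> 'a set set \<Rightarrow> ('a \<times> 'a \<times> 'a) set \<Rightarrow> bool" where
  "config m U C M I \<longleftrightarrow>
    U \<subseteq> V \<and> core U C \<and> 2 * card U \<le> 7 * card C \<and>
    rainbow_matching M \<and> \<Union>M \<inter> U = {} \<and> c ` M \<inter> C = {} \<and>
    cherry_forest I \<and> \<Union>(verts ` I) \<inter> (U \<union> \<Union>M) = {} \<and> (lcol ` I \<union> rcol ` I) \<inter> (C \<union> c ` M) = {} \<and>
    card C + card M + card I = m"

lemma cherry_forest_subset: "cherry_forest I \<Longrightarrow> J \<subseteq> I \<Longrightarrow> cherry_forest J"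
  unfolding cherry_forest_def by (meson finite_subset forest_subset pairwise_subset subsetD)

text \<open>Orienting the forest away from \<open>R\<close> gives every cherry a colour of its own,
  and the edge of that colour is taken.\<close>

lemma cherry_matching:
  assumes "cherry_forest J" "unlinked lcol rcol J R"
  obtains P where "rainbow_matching P" "card P = card J" "\<Union>P \<subseteq> \<Union>(verts ` J)"
    "c ` P \<subseteq> lcol ` J \<union> rcol ` J" "c ` P \<inter> R = {}"
proof -
  have J: "finite J" "\<And>i. i \<in> J \<Longrightarrow> {fst i, fst (snd i)} \<in> E \<and> {fst i, snd (snd i)} \<in> E"
    "pairwise (\<lambda>i j. disjnt (verts i) (verts j)) J" "forest lcol rcol J"
    using assms(1) unfolding cherry_forest_def by auto
  obtain \<phi> where \<phi>: "inj_on \<phi> J" "\<phi> ` J \<inter> R = {}" "\<And>i. i \<in> J \<Longrightarrow> \<phi> i = lcol i \<or> \<phi> i = rcol i"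
    using forest_representatives[OF J(1,4) assms(2)] by blast
  define edge where "edge i = (if \<phi> i = lcol i then {fst i, fst (snd i)} else {fst i, snd (snd i)})" for i
  have edge: "c (edge i) = \<phi> i" "edge i \<subseteq> verts i" "edge i \<in> E" if "i \<in> J" for i
    using \<phi>(3)[OF that] J(2)[OF that] unfolding edge_def lcol_def rcol_def verts_def by auto
  have img: "c ` edge ` J = \<phi> ` J"
    using edge(1) by (force simp: image_image)
  have inj: "inj_on c (edge ` J)"
    using \<phi>(1) edge(1) unfolding inj_on_def by auto
  have inj': "inj_on edge J"
    using \<phi>(1) edge(1) unfolding inj_on_def by metis
  have "disjnt (edge i) (edge j)" if "i \<in> J" "j \<in> J" "i \<noteq> j" for i j
    using edge(2)[OF that(1)] edge(2)[OF that(2)] J(3) that unfolding pairwise_def disjnt_def by blast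
  then have "pairwise disjnt (edge ` J)"
    unfolding pairwise_def by blast
  then have "rainbow_matching (edge ` J)"
    using edge(3) inj unfolding rainbow_matching_def matching_def rainbow_def by auto
  moreover have "card (edge ` J) = card J" using inj' card_image by blast
  moreover have "\<Union>(edge ` J) \<subseteq> \<Union>(verts ` J)" using edge(2) by blast
  moreover have "c ` edge ` J \<subseteq> lcol ` J \<union> rcol ` J" unfolding img
    by (rule image_subsetI) (metis UnI1 UnI2 imageI \<phi>(3))
  moreover have "c ` edge ` J \<inter> R = {}" using img \<phi>(2) by simp
  ultimately show thesis by (rule that)
qed

end

section \<open>Extremal configurations and the two uses of maximality\<close>

locale extremal_config = edge_coloured_graph V E c
  for V :: "'a set" and E and c :: "'a set \<Rightarrow> 'c" +
  fixes k m :: nat and U C M I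
  assumes colour_degree_ge: "v \<in> V \<Longrightarrow> k \<le> colour_degree E c v"
    and edge_needed: "e \<in> E \<Longrightarrow> \<exists>v\<in>V. colour_degree (E - {e}) c v < k"
    and matching_card_le: "rainbow_matching N \<Longrightarrow> card N \<le> m"
    and m_less: "m < k"
    and config: "config m U C M I"
    and core_max: "config m U' C' M' I' \<Longrightarrow> card C' \<le> card C"
    and forest_max: "config m U' C' M' I' \<Longrightarrow> card C' = card C \<Longrightarrow> card I' \<le> card I"
begin

abbreviation "lnk \<equiv> linked lcol rcol"
abbreviation "unl \<equiv> unlinked lcol rcol"

text \<open>The vertices that become available once the cherries in \<open>J\<close> are given up; \<open>avail {}\<close> is the set
  of vertices outside the configuration.\<close>

definition avail :: "('a \<times> 'a \<times> 'a) set \<Rightarrow> 'a set" where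
  "avail J = V - U - \<Union>M - \<Union>(verts ` (I - J))"

text \<open>Colours of cherries count as free, because \<open>cherry_matching\<close> can be made to
  avoid an unlinked set of them.\<close>

definition free :: "'c \<Rightarrow> bool" where
  "free f \<longleftrightarrow> f \<notin> C \<union> c ` M"

lemma config_facts:
  "U \<subseteq> V" "core U C" "2 * card U \<le> 7 * card C"
  "rainbow_matching M" "\<Union>M \<inter> U = {}" "c ` M \<inter> C = {}"
  "cherry_forest I" "\<Union>(verts ` I) \<inter> (U \<union> \<Union>M) = {}" "(lcol ` I \<union> rcol ` I) \<inter> (C \<union> c ` M) = {}"
  "card C + card M + card I = m"
  using config unfolding config_def by - (elim conjE, assumption)+

lemma finite_I: "finite I" and forest_I: "forest lcol rcol I"
  and disjoint_I: "pairwise (\<lambda>i j. disjnt (verts i) (verts j)) I"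
  using config_facts(7) unfolding cherry_forest_def by auto

lemma verts_disjoint: "i \<in> I \<Longrightarrow> j \<in> I \<Longrightarrow> i \<noteq> j \<Longrightarrow> verts i \<inter> verts j = {}"
  using pairwiseD[OF disjoint_I] unfolding disjnt_def .

lemma cherry_edges:
  assumes "i \<in> I"
  shows "{fst i, fst (snd i)} \<in> E" "{fst i, snd (snd i)} \<in> E"
  using config_facts(7) assms unfolding cherry_forest_def by auto

lemma lcol_ne_rcol: "i \<in> I \<Longrightarrow> lcol i \<noteq> rcol i"
  using forest_I linked_refl unfolding forest_def by metis

lemma free_col: "i \<in> I \<Longrightarrow> free (lcol i)" "i \<in> I \<Longrightarrow> free (rcol i)"
  using config_facts(9) unfolding free_def by blast+

lemma verts_avail: "i \<in> J \<Longrightarrow> J \<subseteq> I \<Longrightarrow> verts i \<subseteq> avail J"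
proof -
  assume i: "i \<in> J" "J \<subseteq> I"
  then have "i \<in> I" by blast
  have "verts i \<subseteq> V"
    using cherry_edges[OF \<open>i \<in> I\<close>] edge_subset unfolding verts_def by blast
  moreover have "verts i \<inter> (U \<union> \<Union>M) = {}"
    using config_facts(8) \<open>i \<in> I\<close> by blast
  moreover have "verts i \<inter> verts j = {}" if "j \<in> I - J" for j
    using verts_disjoint[of i j] i that by blast
  ultimately show ?thesis unfolding avail_def by blast
qed

lemma avail_mono: "J \<subseteq> J' \<Longrightarrow> avail J \<subseteq> avail J'"
  unfolding avail_def by blast

lemma card_verts: "i \<in> I \<Longrightarrow> card (verts i) = 3"
  using lcol_ne_rcol[of i] edge_ne cherry_edges[of i] unfolding verts_def lcol_def rcol_def
  by (auto simp: card_insert_if)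

text \<open>Maximality of \<open>m\<close> enters here: \<open>Q\<close> replaces the cherries in
  \<open>J\<close>, the other cherries avoid the colours of \<open>Q\<close>, and the core gives up
  \<open>u\<close>, the one vertex of \<open>Q\<close> that may lie in \<open>U\<close>.\<close>

lemma augment_le:
  assumes "J \<subseteq> I" "rainbow_matching Q" "\<Union>Q \<subseteq> avail J \<union> {u}" "u \<in> avail J \<union> U"
    "\<And>f. f \<in> c ` Q \<Longrightarrow> free f" "unl (I - J) (c ` Q)"
  shows "card Q \<le> card J"
proof -
  obtain P where P: "rainbow_matching P" "card P = card (I - J)" "\<Union>P \<subseteq> \<Union>(verts ` (I - J))"
    "c ` P \<subseteq> lcol ` (I - J) \<union> rcol ` (I - J)" "c ` P \<inter> c ` Q = {}"
    using cherry_matching[OF cherry_forest_subset[OF config_facts(7) Diff_subset] assms(6)] by blast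
  obtain N where N: "rainbow_matching N" "\<Union>N \<subseteq> U" "u \<notin> \<Union>N" "c ` N = C"
    using coreE[OF config_facts(2)] by metis
  have PMN: "\<Union>P \<inter> \<Union>M = {}" "\<Union>P \<inter> U = {}" "c ` P \<inter> C = {}" "c ` P \<inter> c ` M = {}"
    using P(3,4) config_facts(8,9) by blast+
  have Q: "\<Union>Q \<inter> \<Union>M = {}" "\<Union>Q \<inter> \<Union>(verts ` (I - J)) = {}" "\<Union>Q \<inter> U \<subseteq> {u}"
    "c ` Q \<inter> C = {}" "c ` Q \<inter> c ` M = {}"
    subgoal using assms(3,4) config_facts(5) unfolding avail_def by blast
    subgoal using assms(3,4) config_facts(1,8) unfolding avail_def by blast
    subgoal using assms(3) unfolding avail_def by blast
    using assms(5) unfolding free_def by blast+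
  have MN: "rainbow_matching (M \<union> N)" "card (M \<union> N) = card M + card N"
    by (rule rainbow_matching_Un[OF config_facts(4) N(1)]; use N config_facts(5,6) in blast)+
  have PQ: "rainbow_matching (P \<union> Q)" "card (P \<union> Q) = card P + card Q"
    by (rule rainbow_matching_Un[OF P(1) assms(2)]; use P Q in blast)+
  have NQ: "\<Union>N \<inter> \<Union>P = {}" "\<Union>N \<inter> \<Union>Q = {}"
    using N(2,3) PMN(2) Q(3) by blast+
  have "rainbow_matching ((M \<union> N) \<union> (P \<union> Q))" "card ((M \<union> N) \<union> (P \<union> Q)) = card (M \<union> N) + card (P \<union> Q)"
    by (rule rainbow_matching_Un[OF MN(1) PQ(1)];
        use NQ PMN Q N(4) in \<open>simp add: image_Un Int_Un_distrib Int_Un_distrib2 Int_commute\<close>)+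
  then have "card M + card N + card P + card Q \<le> m"
    using matching_card_le MN(2) PQ(2) by fastforce
  moreover have "card N = card C" using N rainbow_matching_card_image by metis
  moreover have "card P + card J = card I"
    using P(2) assms(1) finite_I by (simp add: card_Diff_subset finite_subset card_mono)
  ultimately show ?thesis using config_facts(10) by simp
qed

text \<open>The cherries outside \<open>J\<close> can avoid all of \<open>C'\<close>, so \<open>(U', C')\<close> could be added to the core.\<close>

lemma no_core:
  assumes "J \<subseteq> I" "J \<noteq> {}" "U' \<subseteq> avail J" "core U' C'" "\<And>f. f \<in> C' \<Longrightarrow> free f"
    "card C' = card J" "unl (I - J) C'" "2 * card U' \<le> 7 * card J"
  shows False
proof -
  obtain P where P: "rainbow_matching P" "card P = card (I - J)" "\<Union>P \<subseteq> \<Union>(verts ` (I - J))"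
    "c ` P \<subseteq> lcol ` (I - J) \<union> rcol ` (I - J)" "c ` P \<inter> C' = {}"
    using cherry_matching[OF cherry_forest_subset[OF config_facts(7) Diff_subset] assms(7)] by blast
  have PMN: "\<Union>P \<inter> \<Union>M = {}" "\<Union>P \<inter> U = {}" "c ` P \<inter> C = {}" "c ` P \<inter> c ` M = {}"
    using P(3,4) config_facts(8,9) by blast+
  have U': "U' \<subseteq> V" "U' \<inter> U = {}" "U' \<inter> \<Union>M = {}" "U' \<inter> \<Union>(verts ` (I - J)) = {}"
    "C \<inter> C' = {}" "c ` M \<inter> C' = {}"
    using assms(3,5) unfolding avail_def free_def by blast+
  have PU': "\<Union>P \<inter> U' = {}" using P(3) U'(4) by blast
  have fin: "finite U" "finite U'"
    using U'(1) config_facts(1) finite_vertices finite_subset by blast+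
  have cards: "card (C \<union> C') = card C + card C'"
    using core_finite[OF assms(4)] core_finite[OF config_facts(2)] U'(5) by (simp add: card_Un_disjoint)
  have MP: "rainbow_matching (M \<union> P)" "card (M \<union> P) = card M + card P"
    by (rule rainbow_matching_Un[OF config_facts(4) P(1)]; use PMN in blast)+
  \<comment> \<open>The remaining cherries are replaced by their matching \<open>P\<close>; losing
    them is harmless, since \<open>core_max\<close> compares only the cores.\<close>
  have "config m (U \<union> U') (C \<union> C') (M \<union> P) {}"
    unfolding config_def
  proof (intro conjI)
    show "core (U \<union> U') (C \<union> C')"
      by (rule core_Un[OF config_facts(2) assms(4)]) (use U' in blast)+
    show "2 * card (U \<union> U') \<le> 7 * card (C \<union> C')"
      using fin U'(2) config_facts(3) assms(6,8) cards by (simp add: card_Un_disjoint Int_commute)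
    show "\<Union>(M \<union> P) \<inter> (U \<union> U') = {}"
      using config_facts(5) PMN PU' U' by (simp add: Int_Un_distrib Int_Un_distrib2 Int_commute)
    show "c ` (M \<union> P) \<inter> (C \<union> C') = {}"
      using config_facts(6) PMN P(5) U' by (simp add: image_Un Int_Un_distrib Int_Un_distrib2 Int_commute)
    show "cherry_forest {}"
      by (rule cherry_forest_subset[OF config_facts(7)]) simp
    have "card P + card J = card I"
      using P(2) assms(1) finite_I by (simp add: card_Diff_subset finite_subset card_mono)
    then show "card (C \<union> C') + card (M \<union> P) + card {} = m"
      using cards MP(2) assms(6) config_facts(10) by simp
  qed (use U' config_facts(1) MP in auto)
  then have "card (C \<union> C') \<le> card C" by (rule core_max)
  then have "card J = 0" using cards assms(6) by simp
  then show False using assms(1,2) finite_I finite_subset card_0_eq by blast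
qed

text \<open>If the two colours are not linked without \<open>i\<close>, both edges together augment the matching. Otherwise
  the cherries on the path linking them, together with the two edges, form a core: with both edges
  in use, an arbitrary cherry on the path may stay idle.\<close>

lemma disjoint_free_edges_same_colour:
  assumes i: "i \<in> I" and e: "e1 \<in> E" "e2 \<in> E" "e1 \<inter> e2 = {}" "e1 \<subseteq> avail {i}" "e2 \<subseteq> avail {i}"
    and fr: "free (c e1)" "free (c e2)"
  shows "c e1 = c e2"
proof (rule ccontr)
  assume ne: "c e1 \<noteq> c e2"
  have rm: "rainbow_matching {e1, e2}"
    using rainbow_matching_pair e ne by blast
  show False
  proof (cases "lnk (I - {i}) (c e1) (c e2)")
    case False
    \<comment> \<open>Both edges lie inside \<open>avail {i}\<close>, so any vertex there can serve
      as \<open>u\<close>.\<close>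
    have "card {e1, e2} \<le> card {i}"
      by (rule augment_le[where u = "fst i"])
        (use i e fr rm unlinked_pair[OF False] verts_avail[of i "{i}"] in \<open>auto simp: verts_def\<close>)
    then show False using ne by (auto simp: card_insert_if split: if_splits)
  next
    case True
    obtain J' where J': "J' \<subseteq> I - {i}" "lnk J' (c e1) (c e2)"
      "\<And>j. j \<in> J' \<Longrightarrow> \<not> lnk (J' - {j}) (c e1) (c e2)"
      "\<And>j. j \<in> J' \<Longrightarrow> lnk (J' - {j}) (c e1) (lcol j) \<and> lnk (J' - {j}) (rcol j) (c e2)
        \<or> lnk (J' - {j}) (c e1) (rcol j) \<and> lnk (J' - {j}) (lcol j) (c e2)"
      using minimal_link[OF _ True] finite_I by blast
    have finJ': "finite J'" using J'(1) finite_I finite_subset by blast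
    \<comment> \<open>\<open>D\<close> consists of the colours on the path \<open>J'\<close>; there
      is one more of them than there are cherries.\<close>
    define D where "D = lcol ` J' \<union> rcol ` J'"
    have e12: "c e1 \<in> D" "c e2 \<in> D"
      using linked_endpoint[OF J'(2) ne] linked_endpoint[OF linked_sym[OF J'(2)]] ne unfolding D_def by auto
    then have "J' \<noteq> {}" unfolding D_def by blast
    have toD: "lnk J' (c e1) f" if fD: "f \<in> D" for f
    proof -
      obtain j where j: "j \<in> J'" "f = lcol j \<or> f = rcol j" using fD unfolding D_def by blast
      have mono: "lnk (J' - {j}) s t \<Longrightarrow> lnk J' s t" for s t
        by (erule linked_mono) blast
      show ?thesis
        using J'(4)[OF j(1)] j(2) linked_edge[OF j(1), of lcol rcol] mono
        by (meson linked_sym linked_trans)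
    qed
    have linkD: "lnk J' f g" if "f \<in> D" "g \<in> D" for f g
      using linked_trans[OF linked_sym[OF toD] toD] that .
    have finD: "finite D" unfolding D_def using finJ' by simp
    have cardD: "card D \<le> card J' + 1"
      using linked_card_le[OF finJ' finD linkD] .
    define J where "J = insert i J'"
    have J: "J \<subseteq> I" "J \<noteq> {}" "card J = card J' + 1"
      unfolding J_def using J'(1) i card_insert_disjoint[OF finJ', of i] by auto
    have unlD: "unl (I - J) D"
      unfolding unlinked_def pairwise_def
    proof (intro ballI impI notI)
      fix f g assume fg: "f \<in> D" "g \<in> D" "f \<noteq> g" "lnk (I - J) f g"
      have "lnk J' f g" using linkD fg(1,2) .
      moreover have "lnk (I - J') f g"
        using fg(4) by (rule linked_mono) (auto simp: J_def)
      ultimately show False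
        using forest_no_second_link[OF finite_I forest_I _ _] J'(1) fg(3) by blast
    qed
    define X where "X = e1 \<union> e2 \<union> \<Union>(verts ` J')"
    have avail_i: "avail {i} \<inter> \<Union>(verts ` J') = {}"
      unfolding avail_def using J'(1) by blast
    \<comment> \<open>A rainbow matching of \<open>card J' + 1\<close> edges with colours in
      \<open>D\<close> uses up all of \<open>D\<close>.\<close>
    have full: "\<exists>N. rainbow_matching N \<and> \<Union>N \<subseteq> \<Union>Q \<union> \<Union>(verts ` K) \<and> c ` N = D"
      if Q: "Q \<subseteq> {e1, e2}" "K \<subseteq> J'" "card Q + card K = card J' + 1" "unl K (c ` Q)" for Q K
    proof -
      have "cherry_forest K"
        using cherry_forest_subset[OF config_facts(7)] J'(1) Q(2) by blast
      then obtain P where P: "rainbow_matching P" "card P = card K" "\<Union>P \<subseteq> \<Union>(verts ` K)"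
        "c ` P \<subseteq> lcol ` K \<union> rcol ` K" "c ` P \<inter> c ` Q = {}"
        using cherry_matching Q(4) by blast
      have "\<Union>P \<subseteq> \<Union>(verts ` J')" using P(3) Q(2) by blast
      moreover have "\<Union>Q \<subseteq> avail {i}" using Q(1) e(4,5) by blast
      ultimately have "\<Union>P \<inter> \<Union>Q = {}" using avail_i by blast
      note PQ = rainbow_matching_Un[OF P(1) rainbow_matching_subset[OF rm Q(1)] this P(5)]
      have "c ` P \<subseteq> D" using P(4) Q(2) unfolding D_def by blast
      moreover have "c ` Q \<subseteq> D" using Q(1) e12 by blast
      ultimately have "c ` (P \<union> Q) \<subseteq> D" by (simp add: image_Un)
      moreover have "card D \<le> card (c ` (P \<union> Q))"
        using rainbow_matching_card_image[OF PQ(1)] PQ(2) P(2) Q(3) cardD by simp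
      ultimately have "c ` (P \<union> Q) = D"
        using card_seteq finD by blast
      then show ?thesis using PQ(1) P(3) by (intro exI[of _ "P \<union> Q"]) auto
    qed
    \<comment> \<open>If \<open>u\<close> lies in a cherry of the path, that cherry stays idle;
      otherwise all these cherries are used, with one of the two edges that misses
      \<open>u\<close>.\<close>
    have avoid: "\<exists>N. rainbow_matching N \<and> \<Union>N \<subseteq> X - {u} \<and> c ` N = D" for u
    proof -
      have idle: ?thesis if j: "j \<in> J'" "u \<in> verts j" for j
      proof -
        have "u \<notin> e1 \<union> e2" using avail_i e j by blast
        moreover have "u \<notin> \<Union>(verts ` (J' - {j}))"
          using verts_disjoint[of j] j J'(1) by blast
        moreover have "card {e1, e2} + card (J' - {j}) = card J' + 1"
        proof -
          have "card J' > 0" using j(1) finJ' by (auto simp: card_gt_0_iff)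
          moreover have "card {e1, e2} = 2" using ne by (metis card_2_iff)
          ultimately show ?thesis using j(1) finJ' by simp
        qed
        moreover have "unl (J' - {j}) (c ` {e1, e2})"
          using unlinked_pair[OF J'(3)[OF j(1)]] by simp
        ultimately obtain N where N: "rainbow_matching N" "c ` N = D"
            "\<Union>N \<subseteq> \<Union>{e1, e2} \<union> \<Union>(verts ` (J' - {j}))" "u \<notin> \<Union>N"
          using full[of "{e1, e2}" "J' - {j}"] by blast
        have "\<Union>N \<subseteq> X" using N(3) unfolding X_def by blast
        then show ?thesis using N by blast
      qed
      have one: "\<exists>N. rainbow_matching N \<and> \<Union>N \<subseteq> e \<union> \<Union>(verts ` J') \<and> c ` N = D" if "e \<in> {e1, e2}" for e
        using full[of "{e}" J'] that by auto
      consider (v) j where "j \<in> J'" "u \<in> verts j" | (1) "u \<notin> \<Union>(verts ` J')" "u \<notin> e1"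
        | (2) "u \<notin> \<Union>(verts ` J')" "u \<notin> e2"
        using e(3) by blast
      then show ?thesis
      proof cases
        case v then show ?thesis by (rule idle)
      next
        case 1 then show ?thesis using one[of e1] unfolding X_def by blast
      next
        case 2 then show ?thesis using one[of e2] unfolding X_def by blast
      qed
    qed
    have "core X D" unfolding core_def using avoid by blast
    \<comment> \<open>For the lower bound, the cherries are matched so as to avoid
      \<open>c e1\<close>, which then counts as one further colour.\<close>
    moreover have "card D = card J"
    proof -
      have "J' \<subseteq> I" using J'(1) by blast
      obtain P where P: "rainbow_matching P" "card P = card J'" "\<Union>P \<subseteq> \<Union>(verts ` J')"
        "c ` P \<subseteq> lcol ` J' \<union> rcol ` J'" "c ` P \<inter> {c e1} = {}"
        using cherry_matching[OF cherry_forest_subset[OF config_facts(7) \<open>J' \<subseteq> I\<close>] unlinked_singleton(1)] .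
      have "insert (c e1) (c ` P) \<subseteq> D" using P(4) e12 unfolding D_def by blast
      then have "card (insert (c e1) (c ` P)) \<le> card D" using finD card_mono by blast
      moreover have "card (insert (c e1) (c ` P)) = card J' + 1"
        using P rainbow_matching_card_image[OF P(1)] rainbow_matching_finite[OF P(1)] by simp
      ultimately show ?thesis using cardD J(3) by simp
    qed
    moreover have "X \<subseteq> avail J"
    proof -
      have "verts j \<subseteq> avail J" if "j \<in> J'" for j
        by (rule verts_avail) (use that J(1) in \<open>auto simp: J_def\<close>)
      moreover have "avail {i} \<subseteq> avail J" by (rule avail_mono) (simp add: J_def)
      ultimately show ?thesis using e unfolding X_def by blast
    qed
    moreover have "free f" if "f \<in> D" for f
      using that free_col J'(1) unfolding D_def by blast
    \<comment> \<open>\<open>8 + 6 * card J' \<le> 7 * card J' + 7\<close> holds because the path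
      has at least one edge.\<close>
    moreover have "2 * card X \<le> 7 * card J"
    proof -
      have "card (\<Union>(verts ` J')) \<le> (\<Sum>j\<in>J'. card (verts j))"
        using card_UN_le[OF finJ'] by simp
      also have "\<dots> = (\<Sum>j\<in>J'. 3)"
        by (rule sum.cong[OF refl]) (use card_verts J'(1) in blast)
      also have "\<dots> = 3 * card J'" by simp
      finally have "card X \<le> card e1 + card e2 + 3 * card J'"
        unfolding X_def by (meson add_mono card_Un_le order_trans order_refl)
      then have "card X \<le> 4 + 3 * card J'" using card_edge e by simp
      moreover have "card J' > 0" using \<open>J' \<noteq> {}\<close> finJ' by (simp add: card_gt_0_iff)
      ultimately show ?thesis using J(3) by simp
    qed
    ultimately show False using no_core[OF J(1,2)] unlD by blast
  qed
qed

end

section \<open>Counting the colours sent to the cherries\<close>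

context extremal_config
begin

text \<open>Two pairs of disjoint equally coloured edges that share a vertex form a core with two colours
  and at most seven vertices.\<close>

lemma no_shared_pairs:
  assumes ij: "i \<in> I" "j \<in> I" "i \<noteq> j"
    and E: "e1 \<in> E" "e2 \<in> E" "e3 \<in> E" "e4 \<in> E"
    and sub: "e1 \<subseteq> avail {i, j}" "e2 \<subseteq> avail {i, j}" "e3 \<subseteq> avail {i, j}" "e4 \<subseteq> avail {i, j}"
    and dis: "e1 \<inter> e2 = {}" "e3 \<inter> e4 = {}" "e1 \<inter> e3 = {}" "e1 \<inter> e4 = {}" "e2 \<inter> e3 = {}"
    and meet: "e2 \<inter> e4 \<noteq> {}"
    and col: "c e1 = f" "c e2 = f" "c e3 = g" "c e4 = g" "free f" "free g"
  shows "lnk (I - {i, j}) f g"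
proof (rule ccontr)
  assume nl: "\<not> lnk (I - {i, j}) f g"
  then have fg: "f \<noteq> g" by auto
  define X where "X = e1 \<union> e2 \<union> e3 \<union> e4"
  have rm: "rainbow_matching {e1, e3}" "rainbow_matching {e1, e4}" "rainbow_matching {e2, e3}"
    using rainbow_matching_pair E dis col fg by metis+
  have "\<exists>N. rainbow_matching N \<and> \<Union>N \<subseteq> X - {u} \<and> c ` N = {f, g}" for u
  proof -
    \<comment> \<open>\<open>e2\<close> and \<open>e4\<close> overlap, so no matching chosen below
      contains both.\<close>
    consider "u \<in> e1" | "u \<in> e3" | "u \<notin> e1" "u \<notin> e3" by blast
    then show ?thesis
    proof cases
      case 1
      then have "\<Union>{e2, e3} \<subseteq> X - {u}" using dis unfolding X_def by blast
      then show ?thesis using rm(3) col by (intro exI[of _ "{e2, e3}"]) simp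
    next
      case 2
      then have "\<Union>{e1, e4} \<subseteq> X - {u}" using dis unfolding X_def by blast
      then show ?thesis using rm(2) col by (intro exI[of _ "{e1, e4}"]) simp
    next
      case 3
      then have "\<Union>{e1, e3} \<subseteq> X - {u}" unfolding X_def by blast
      then show ?thesis using rm(1) col by (intro exI[of _ "{e1, e3}"]) simp
    qed
  qed
  then have core: "core X {f, g}" unfolding core_def by blast
  have fin: "finite e" if "e \<in> E" for e
    using that edge_subset finite_vertices finite_subset by blast
  have "card (e2 \<inter> e4) > 0" using meet fin[OF E(2)] by (simp add: card_gt_0_iff)
  then have "card (e2 \<union> e4) \<le> 3"
    using card_Un_Int[OF fin fin, OF E(2) E(4)] card_edge E by simp
  moreover have "card (e1 \<union> e3) \<le> 4"
    using card_Un_le[of e1 e3] card_edge E by simp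
  moreover have "X = (e1 \<union> e3) \<union> (e2 \<union> e4)" unfolding X_def by blast
  ultimately have "card X \<le> 7" using card_Un_le[of "e1 \<union> e3" "e2 \<union> e4"] by simp
  moreover have "X \<subseteq> avail {i, j}" unfolding X_def using sub by blast
  moreover have "card {i, j} = 2" "card {f, g} = 2" using ij(3) fg by simp_all
  ultimately show False
    using no_core[of "{i, j}" X "{f, g}"] ij core col(5,6) unlinked_pair[OF nl] by auto
qed

text \<open>Otherwise \<open>{u, w}\<close> either enlarges the rainbow matching, with the core
  giving up \<open>u\<close> if necessary, or forms a new cherry with the edge of \<open>M\<close>
  at \<open>u\<close>, against \<open>forest_max\<close>.\<close>

lemma free_edge_meets_cherry:
  assumes w: "w \<in> avail {}" and e: "{u, w} \<in> E" and fr: "free (c {u, w})"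
  shows "u \<in> \<Union>(verts ` I)"
proof (rule ccontr)
  assume u: "u \<notin> \<Union>(verts ` I)"
  have "u \<in> V" using e edge_subset by blast
  then consider "u \<in> avail {} \<union> U" | "u \<in> \<Union>M" using u unfolding avail_def by blast
  then show False
  proof cases
    case 1
    have "card {{u, w}} \<le> card ({} :: ('a \<times> 'a \<times> 'a) set)"
      by (rule augment_le[where u = u]) (use 1 w e fr in auto)
    then show False by simp
  next
    case 2
    then obtain e0 where e0: "e0 \<in> M" "u \<in> e0" by blast
    have "e0 \<in> E" using e0(1) config_facts(4) rainbow_matching_subset_E by blast
    from edge_other_end[OF this e0(2)] obtain v where "e0 = {v, u}" .
    then have v: "e0 = {u, v}" by auto
    define t where "t = (u, v, w)"
    have t: "verts t = {u, v, w}" "lcol t = c e0" "rcol t = c {u, w}"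
      unfolding t_def verts_def lcol_def rcol_def v by simp_all
    \<comment> \<open>No cherry has the colour of an edge of \<open>M\<close>, so the new cherry is
      a pendant edge at \<open>c e0\<close> and closes no cycle.\<close>
    have iso: "c e0 \<notin> lcol ` I \<union> rcol ` I" using config_facts(9) imageI[OF e0(1), of c] by blast
    have ne: "c e0 \<noteq> c {u, w}" using fr imageI[OF e0(1), of c] unfolding free_def by (metis UnI2)
    have eq: "f = c e0" if "J \<subseteq> I" "lnk J f (c e0) \<or> lnk J (c e0) f" for J f
    proof (rule ccontr)
      assume *: "f \<noteq> c e0"
      have "lnk J (c e0) f" using that(2) by (elim disjE) (rule linked_sym)
      then have "c e0 \<in> lcol ` J \<union> rcol ` J" using linked_endpoint * by metis
      then show False using that(1) iso by blast
    qed
    have tI: "t \<notin> I" using config_facts(8) 2 t(1) by blast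
    have forest: "forest lcol rcol (insert t I)"
      unfolding forest_def
    proof
      fix i assume "i \<in> insert t I"
      then consider "i = t" | "i \<in> I" "i \<noteq> t" by blast
      then show "\<not> lnk (insert t I - {i}) (lcol i) (rcol i)"
      proof cases
        case 1
        then show ?thesis using eq[of I "c {u, w}"] ne t tI by auto
      next
        case i: 2
        have "insert t I - {i} = insert t (I - {i})" using i by blast
        moreover have "\<not> lnk (I - {i}) (lcol i) (rcol i)"
          using forest_I i(1) unfolding forest_def by blast
        moreover have "lcol i \<noteq> c e0" "rcol i \<noteq> c e0" using iso i(1) by (metis UnCI imageI)+
        ultimately show ?thesis
          using linked_insert[of lcol rcol t "I - {i}" "lcol i" "rcol i"] eq[OF Diff_subset] t(2) by metis
      qed
    qed
    have "verts i \<inter> verts t = {}" if "i \<in> I" for i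
    proof -
      have "u \<notin> verts i" "v \<notin> verts i" using config_facts(8) e0(1) v that by blast+
      moreover have "w \<notin> verts i" using w that unfolding avail_def by blast
      ultimately show ?thesis unfolding t(1) by blast
    qed
    then have "pairwise (\<lambda>i j. disjnt (verts i) (verts j)) (insert t I)"
      using disjoint_I by (auto simp: pairwise_insert disjnt_def Int_commute)
    then have cf: "cherry_forest (insert t I)"
      using config_facts(7) forest e \<open>e0 \<in> E\<close> v unfolding cherry_forest_def t_def by simp
    have c0: "c e0 \<notin> c ` (M - {e0})"
      using config_facts(4) e0(1) unfolding rainbow_matching_def rainbow_def inj_on_def by blast
    have disj: "e0 \<inter> \<Union>(M - {e0}) = {}"
      using config_facts(4) e0(1) unfolding rainbow_matching_def matching_def pairwise_def disjnt_def by blast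
    have finM: "finite M" using config_facts(4) rainbow_matching_finite by blast
    have "config m U C (M - {e0}) (insert t I)"
      unfolding config_def
    proof (intro conjI)
      show "rainbow_matching (M - {e0})" using config_facts(4) rainbow_matching_subset by blast
      have "verts t \<inter> (U \<union> \<Union>(M - {e0})) = {}"
        using disj config_facts(5) e0(1) w unfolding t(1) v avail_def by blast
      moreover have "\<Union>(verts ` I) \<inter> (U \<union> \<Union>(M - {e0})) = {}" using config_facts(8) by blast
      ultimately show "\<Union>(verts ` insert t I) \<inter> (U \<union> \<Union>(M - {e0})) = {}" by blast
      have "lcol t \<notin> C \<union> c ` (M - {e0})" using t(2) c0 config_facts(6) e0(1) by auto
      moreover have "rcol t \<notin> C \<union> c ` (M - {e0})" using t(3) fr unfolding free_def by auto
      moreover have "(lcol ` I \<union> rcol ` I) \<inter> (C \<union> c ` (M - {e0})) = {}" using config_facts(9) by blast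
      ultimately show "(lcol ` insert t I \<union> rcol ` insert t I) \<inter> (C \<union> c ` (M - {e0})) = {}" by blast
      have "card M > 0" using e0(1) finM by (auto simp: card_gt_0_iff)
      then show "card C + card (M - {e0}) + card (insert t I) = m"
        using config_facts(10) e0(1) finM finite_I tI by simp
    qed (use config_facts cf in auto)
    then have "card (insert t I) \<le> card I" using forest_max by blast
    then show False using tI finite_I by simp
  qed
qed

section \<open>Colours received by the outside vertices\<close>

definition cols :: "'a \<Rightarrow> 'a \<times> 'a \<times> 'a \<Rightarrow> 'c set" where
  "cols w i = (\<lambda>u. c {u, w}) ` {u \<in> verts i. {u, w} \<in> E \<and> free (c {u, w})}"

lemma finite_cols [simp]: "finite (cols w i)"
  unfolding cols_def verts_def by simp

text \<open>Of the at least \<open>m + 1\<close> colours at \<open>w\<close>, at most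
  \<open>card C + card M\<close> are not free, and the free ones come from cherries.\<close>

lemma sum_cols_ge:
  assumes w: "w \<in> avail {}"
  shows "card I + 1 \<le> (\<Sum>i\<in>I. card (cols w i))"
proof -
  have "c ` {e \<in> E. w \<in> e} \<subseteq> C \<union> c ` M \<union> (\<Union>i\<in>I. cols w i)"
  proof
    fix f assume "f \<in> c ` {e \<in> E. w \<in> e}"
    then obtain e where e: "e \<in> E" "w \<in> e" "f = c e" by blast
    from edge_other_end[OF e(1,2)] obtain u where u: "e = {u, w}" .
    show "f \<in> C \<union> c ` M \<union> (\<Union>i\<in>I. cols w i)"
    proof (cases "free f")
      case True
      then obtain i where "i \<in> I" "u \<in> verts i"
        using free_edge_meets_cherry[OF w] e u by blast
      then have "f \<in> cols w i" using True e u unfolding cols_def by blast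
      then show ?thesis using \<open>i \<in> I\<close> by blast
    qed (auto simp: free_def)
  qed
  moreover have fin: "finite C" "finite (c ` M)" "finite (\<Union>i\<in>I. cols w i)"
    using core_finite[OF config_facts(2)] rainbow_matching_finite[OF config_facts(4)] finite_I by auto
  ultimately have "card (c ` {e \<in> E. w \<in> e}) \<le> card (C \<union> c ` M \<union> (\<Union>i\<in>I. cols w i))"
    by (intro card_mono) auto
  also have "\<dots> \<le> card C + card (c ` M) + card (\<Union>i\<in>I. cols w i)"
    by (meson add_le_mono card_Un_le order_refl order_trans)
  also have "\<dots> \<le> card C + card M + (\<Sum>i\<in>I. card (cols w i))"
    using card_UN_le[OF finite_I] rainbow_matching_card_image[OF config_facts(4)] by (simp add: add_mono)
  finally have "colour_degree E c w \<le> card C + card M + (\<Sum>i\<in>I. card (cols w i))"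
    unfolding colour_degree_def .
  moreover have "k \<le> colour_degree E c w"
    using colour_degree_ge w unfolding avail_def by blast
  ultimately show ?thesis using config_facts(10) m_less by linarith
qed

text \<open>Either leaf may play the role of \<open>y\<close>, so that each argument about a leaf is
  given once.\<close>

definition oriented :: "'a \<times> 'a \<times> 'a \<Rightarrow> 'a \<Rightarrow> 'a \<Rightarrow> 'a \<Rightarrow> bool" where
  "oriented i x y z \<longleftrightarrow> i \<in> I \<and> (i = (x, y, z) \<or> i = (x, z, y))"

lemma oriented_swap: "oriented i x y z \<Longrightarrow> oriented i x z y"
  unfolding oriented_def by blast

lemma oriented_facts:
  assumes "oriented i x y z"
  shows "i \<in> I" "verts i = {x, y, z}" "{x, y} \<in> E" "{x, z} \<in> E"
    "free (c {x, y})" "free (c {x, z})" "{lcol i, rcol i} = {c {x, y}, c {x, z}}"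
    "c {x, y} \<noteq> c {x, z}" "x \<noteq> y" "x \<noteq> z" "y \<noteq> z"
proof -
  show i: "i \<in> I" using assms unfolding oriented_def by blast
  show v: "verts i = {x, y, z}" and "{x, y} \<in> E" and "{x, z} \<in> E"
    and "{lcol i, rcol i} = {c {x, y}, c {x, z}}"
    using assms cherry_edges[OF i] unfolding oriented_def verts_def lcol_def rcol_def by auto
  show "free (c {x, y})" "free (c {x, z})" "c {x, y} \<noteq> c {x, z}"
    using assms free_col[OF i] lcol_ne_rcol[OF i] unfolding oriented_def lcol_def rcol_def by auto
  show "x \<noteq> y" "x \<noteq> z" "y \<noteq> z"
    using card_verts[OF i] unfolding v by (auto simp: card_insert_if split: if_splits)
qed

lemma avail_notin_verts: "w \<in> avail {} \<Longrightarrow> i \<in> I \<Longrightarrow> w \<notin> verts i"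
  unfolding avail_def by blast

text \<open>The disjoint edges \<open>{y, w}\<close> and \<open>{x, z}\<close> both become available
  when \<open>i\<close> is given up.\<close>

lemma leaf_colour:
  assumes o: "oriented i x y z" and w: "w \<in> avail {}" and e: "{y, w} \<in> E" "free (c {y, w})"
  shows "c {y, w} = c {x, z}"
proof -
  note f = oriented_facts[OF o]
  have "w \<notin> {x, y, z}" using avail_notin_verts[OF w f(1)] f(2) by simp
  moreover have "{x, y, z} \<subseteq> avail {i}" using verts_avail[of i "{i}"] f(1,2) by simp
  moreover have "w \<in> avail {i}" using w avail_mono by blast
  ultimately show ?thesis
    by (intro disjoint_free_edges_same_colour[OF f(1) e(1) f(4)]) (use f e in auto)
qed

text \<open>If \<open>u \<noteq> y\<close>, then \<open>{u, w'}\<close> and \<open>{y, w}\<close>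
  are disjoint and must agree in colour; for \<open>u = z\<close> this colour would also be that of
  \<open>{x, y}\<close>.\<close>

lemma cols_other:
  assumes o: "oriented i x y z" and w: "w \<in> avail {}" and e: "{y, w} \<in> E" "free (c {y, w})"
    and w': "w' \<in> avail {}" "w' \<noteq> w" and u: "u \<in> verts i" "{u, w'} \<in> E" "free (c {u, w'})"
  shows "u \<in> {x, y} \<and> c {u, w'} = c {x, z}"
proof -
  note f = oriented_facts[OF o]
  have nv: "w \<notin> {x, y, z}" "w' \<notin> {x, y, z}"
    using avail_notin_verts[OF _ f(1)] w w' f(2) by simp_all
  have av: "{x, y, z} \<subseteq> avail {i}" using verts_avail[of i "{i}"] f(1,2) by simp
  have avw: "w \<in> avail {i}" "w' \<in> avail {i}" using w w' avail_mono by blast+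
  have yw: "c {y, w} = c {x, z}" using leaf_colour[OF o w e] .
  show ?thesis
  proof (cases "u = y")
    case True
    then show ?thesis using leaf_colour[OF o w'(1)] u by simp
  next
    case False
    then have eq: "c {u, w'} = c {y, w}"
      by (intro disjoint_free_edges_same_colour[OF f(1) u(2) e(1)])
        (use u e nv av avw w' f(2) in auto)
    have "u \<noteq> z"
    proof
      assume "u = z"
      then have "c {u, w'} = c {x, y}"
        using leaf_colour[OF oriented_swap[OF o] w'(1)] u by simp
      then show False using eq yw f(8) by simp
    qed
    then show ?thesis using u(1) False f(2) eq yw by auto
  qed
qed

text \<open>Read with \<open>oriented i x y z\<close>: some edge \<open>yw\<close> repeats the colour of \<open>xz\<close>, and every outside vertex
  sends this colour to \<open>x\<close> or \<open>y\<close>. Only such cherries receive more colours than there are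
  outside vertices.\<close>

definition twin :: "'a \<Rightarrow> 'a \<Rightarrow> 'a \<Rightarrow> bool" where
  "twin x y z \<longleftrightarrow> (\<exists>w\<in>avail {}. {y, w} \<in> E \<and> c {y, w} = c {x, z}) \<and>
    (\<forall>w\<in>avail {}. \<exists>u\<in>{x, y}. {u, w} \<in> E \<and> c {u, w} = c {x, z})"

lemma finite_avail [simp]: "finite (avail J)"
  using finite_vertices unfolding avail_def by simp

text \<open>If both leaves send free colours to \<open>w\<close>, the other outside vertices receive
  none. Otherwise \<open>w\<close> receives at most two colours and the others at most the colour of
  \<open>{x, z}\<close>, so an excess forces each of them to receive it.\<close>

lemma sum_cols_leaf:
  assumes o: "oriented i x y z" and w: "w \<in> avail {}" and e: "{y, w} \<in> E" "free (c {y, w})"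
    and p: "3 \<le> card (avail {})"
  shows "(\<Sum>w\<in>avail {}. card (cols w i)) \<le> card (avail {}) \<or>
    (\<Sum>w\<in>avail {}. card (cols w i)) \<le> card (avail {}) + 1 \<and> twin x y z"
proof -
  note f = oriented_facts[OF o]
  have sub: "cols w' i \<subseteq> {c {x, z}}" if "w' \<in> avail {} - {w}" for w'
    using cols_other[OF o w e] that unfolding cols_def by blast
  have split: "(\<Sum>w\<in>avail {}. card (cols w i)) = card (cols w i) + (\<Sum>w'\<in>avail {} - {w}. card (cols w' i))"
    using w by (simp add: sum.remove)
  have le1: "card (cols w' i) \<le> 1" if "w' \<in> avail {} - {w}" for w'
    using card_mono[OF _ sub[OF that]] by simp
  show ?thesis
  proof (cases "{z, w} \<in> E \<and> free (c {z, w})")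
    case True
    then have "cols w' i \<subseteq> {c {x, y}}" if "w' \<in> avail {} - {w}" for w'
      using cols_other[OF oriented_swap[OF o] w] that unfolding cols_def by blast
    then have "cols w' i = {}" if "w' \<in> avail {} - {w}" for w'
      using sub[OF that] that f(8) by blast
    then have "(\<Sum>w'\<in>avail {} - {w}. card (cols w' i)) = 0" by simp
    \<comment> \<open>\<open>w\<close> may receive three colours, one from each vertex of the
      cherry; this is absorbed by \<open>p\<close>.\<close>
    moreover have "card (cols w i) \<le> card (verts i)"
      unfolding cols_def by (rule order_trans[OF card_image_le card_mono]) (auto simp: verts_def)
    ultimately show ?thesis using split card_verts[OF f(1)] p by simp
  next
    case False
    then have "cols w i \<subseteq> {c {x, w}, c {y, w}}" unfolding cols_def f(2) by blast
    then have "card (cols w i) \<le> card {c {x, w}, c {y, w}}" by (rule card_mono[rotated]) simp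
    also have "\<dots> \<le> 2" by (simp add: card_insert_if)
    finally have two: "card (cols w i) \<le> 2" .
    have cw: "card (avail {} - {w}) + 1 = card (avail {})"
      using w p by (simp add: card_Diff_singleton)
    have le: "(\<Sum>w'\<in>avail {} - {w}. card (cols w' i)) \<le> card (avail {} - {w})"
      using sum_bounded_above[of "avail {} - {w}" "\<lambda>w'. card (cols w' i)" 1] le1 by simp
    show ?thesis
    proof (cases "\<exists>w'\<in>avail {} - {w}. cols w' i = {}")
      case True
      then obtain w' where w': "w' \<in> avail {} - {w}" "cols w' i = {}" by blast
      have "(\<Sum>v\<in>avail {} - {w}. card (cols v i)) = (\<Sum>v\<in>avail {} - {w} - {w'}. card (cols v i))"
        using w' by (simp add: sum.remove)
      also have "\<dots> \<le> card (avail {} - {w} - {w'})"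
        using sum_bounded_above[of "avail {} - {w} - {w'}" "\<lambda>v. card (cols v i)" 1] le1 by simp
      also have "\<dots> + 1 = card (avail {} - {w})"
        using w' card_Suc_Diff1[of "avail {} - {w}" w'] by simp
      finally show ?thesis using split two cw by simp
    next
      case False
      have yw: "c {y, w} = c {x, z}" using leaf_colour[OF o w e] .
      have "\<exists>u\<in>{x, y}. {u, w'} \<in> E \<and> c {u, w'} = c {x, z}" if w': "w' \<in> avail {}" for w'
      proof (cases "w' = w")
        case True then show ?thesis using e yw by blast
      next
        case ne: False
        then obtain u where "u \<in> verts i" "{u, w'} \<in> E" "free (c {u, w'})"
          using False w' unfolding cols_def by blast
        then show ?thesis using cols_other[OF o w e w' ne] by blast
      qed
      then have "twin x y z" unfolding twin_def using w e yw by blast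
      then show ?thesis using split two cw le by simp
    qed
  qed
qed

definition good :: "('a \<times> 'a \<times> 'a) set" where
  "good = {i. \<exists>x y z. oriented i x y z \<and> twin x y z}"

lemma sum_cols_le:
  assumes i: "i \<in> I" and p: "3 \<le> card (avail {})"
  shows "(\<Sum>w\<in>avail {}. card (cols w i)) \<le> card (avail {}) + (if i \<in> good then 1 else 0)"
proof (cases "\<forall>w\<in>avail {}. card (cols w i) \<le> 1")
  case True
  then have "(\<Sum>w\<in>avail {}. card (cols w i)) \<le> card (avail {})"
    using sum_bounded_above[of "avail {}" "\<lambda>w'. card (cols w' i)" 1] by simp
  then show ?thesis by simp
next
  case False
  then obtain w where w: "w \<in> avail {}" "\<not> card (cols w i) \<le> 1" by blast
  obtain x y z where xyz: "i = (x, y, z)" by (cases i)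
  have o: "oriented i x y z" using i xyz unfolding oriented_def by blast
  have "\<not> cols w i \<subseteq> {c {x, w}}"
    using w(2) card_mono[of "{c {x, w}}" "cols w i"] by auto
  then consider "{y, w} \<in> E" "free (c {y, w})" | "{z, w} \<in> E" "free (c {z, w})"
    unfolding cols_def oriented_facts(2)[OF o] by blast
  then show ?thesis
  proof cases
    case 1
    show ?thesis using sum_cols_leaf[OF o w(1) 1 p] o unfolding good_def by auto
  next
    case 2
    show ?thesis using sum_cols_leaf[OF oriented_swap[OF o] w(1) 2 p] oriented_swap[OF o]
      unfolding good_def by auto
  qed
qed

lemma good_subset: "good \<subseteq> I"
  unfolding good_def oriented_def by blast

text \<open>Double counting gives \<open>p * (r + 1) \<le> p * r + card good\<close> for
  \<open>p\<close> outside vertices and \<open>r\<close> cherries.\<close>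

lemma card_avail_le_card_good:
  assumes p: "3 \<le> card (avail {})"
  shows "card (avail {}) \<le> card good"
proof -
  have "card (avail {}) * (card I + 1) \<le> (\<Sum>w\<in>avail {}. \<Sum>i\<in>I. card (cols w i))"
    using sum_bounded_below[of "avail {}" "card I + 1"] sum_cols_ge by simp
  also have "\<dots> = (\<Sum>i\<in>I. \<Sum>w\<in>avail {}. card (cols w i))" by (rule sum.swap)
  also have "\<dots> \<le> (\<Sum>i\<in>I. card (avail {}) + (if i \<in> good then 1 else 0))"
    using sum_cols_le[OF _ p] by (rule sum_mono)
  also have "\<dots> = card I * card (avail {}) + card good"
  proof -
    have "(\<Sum>i\<in>I. if i \<in> good then 1 else 0) = card (I \<inter> good)"
      using finite_I by (simp add: sum.If_cases)
    then show ?thesis using good_subset by (simp add: sum.distrib Int_absorb1)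
  qed
  finally show ?thesis by (simp add: algebra_simps)
qed

section \<open>Special cherries within a single tree\<close>

text \<open>Both repeated colours reach a common outside vertex \<open>w'\<close>. If they were
  unlinked, \<open>no_shared_pairs\<close> would apply to two pairs of edges meeting in
  \<open>w'\<close>.\<close>

lemma twins_linked:
  assumes o: "oriented i x y z" "oriented j x' y' z'" and ne: "i \<noteq> j"
    and t: "twin x y z" "twin x' y' z'"
  shows "lnk (I - {i, j}) (c {x, z}) (c {x', z'})"
proof -
  note f = oriented_facts[OF o(1)] and f' = oriented_facts[OF o(2)]
  have dis: "{x, y, z} \<inter> {x', y', z'} = {}"
    using verts_disjoint[OF f(1) f'(1) ne] f(2) f'(2) by simp
  have av: "{x, y, z} \<subseteq> avail {i, j}" "{x', y', z'} \<subseteq> avail {i, j}"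
    using verts_avail[of i "{i, j}"] verts_avail[of j "{i, j}"] f(1,2) f'(1,2) by simp_all
  have avw: "w \<in> avail {i, j}" "w \<notin> {x, y, z}" "w \<notin> {x', y', z'}" if "w \<in> avail {}" for w
    using that avail_mono[of "{}" "{i, j}"] avail_notin_verts[OF that f(1)] avail_notin_verts[OF that f'(1)]
      f(2) f'(2) by auto
  obtain w' where w': "w' \<in> avail {}" "{y', w'} \<in> E" "c {y', w'} = c {x', z'}"
    using t(2) unfolding twin_def by blast
  obtain w where w: "w \<in> avail {}" "{y, w} \<in> E" "c {y, w} = c {x, z}"
    using t(1) unfolding twin_def by blast
  obtain u where u: "u \<in> {x, y}" "{u, w'} \<in> E" "c {u, w'} = c {x, z}"
    using t(1) w'(1) unfolding twin_def by blast
  note step = no_shared_pairs[OF f(1) f'(1) ne _ _ f'(4) w'(2) _ _ _ _ _ _ _ _ _ _ _ _ refl w'(3) f(6) f'(6)]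
  show ?thesis
  \<comment> \<open>Here \<open>{x, z}\<close> and \<open>{y, w'}\<close> form the first pair. In
    the other case \<open>u = x\<close> and \<open>w \<noteq> w'\<close>, so \<open>{y, w}\<close>
    and \<open>{x, w'}\<close> do.\<close>
  proof (cases "u = y \<or> w = w'")
    case True
    then have "{y, w'} \<in> E" "c {y, w'} = c {x, z}" using u w by auto
    then show ?thesis
      by (intro step[of "{x, z}" "{y, w'}"]) (use f f' dis av avw[OF w'(1)] in auto)
  next
    case False
    then show ?thesis
      using u w by (intro step[of "{y, w}" "{x, w'}"]) (use f f' dis av avw[OF w'(1)] avw[OF w(1)] in auto)
  qed
qed

text \<open>Otherwise \<open>uw\<close> could be deleted without lowering any colour degree.\<close>

lemma edge_colour_unique_at_end:
  assumes "{u, w} \<in> E" "{u, w'} \<in> E" "{v, w} \<in> E" "w \<noteq> w'" "u \<noteq> v"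
    and "c {u, w'} = c {u, w}" "c {v, w} = c {u, w}"
  shows False
proof -
  let ?e = "{u, w}"
  obtain s where s: "s \<in> V" "colour_degree (E - {?e}) c s < k"
    using edge_needed[OF assms(1)] by blast
  have "{u, w'} \<noteq> ?e" "{v, w} \<noteq> ?e" using assms(4,5) by (auto simp: doubleton_eq_iff)
  then have "c ?e \<in> c ` {e \<in> E - {?e}. s \<in> e}" if "s \<in> ?e"
  proof (cases "s = u")
    case True
    then show ?thesis using assms(2,6) \<open>{u, w'} \<noteq> ?e\<close> by (intro image_eqI[of _ _ "{u, w'}"]) auto
  next
    case False
    then show ?thesis using that assms(3,7) \<open>{v, w} \<noteq> ?e\<close> by (intro image_eqI[of _ _ "{v, w}"]) auto
  qed
  then have "c ` {e \<in> E. s \<in> e} \<subseteq> c ` {e \<in> E - {?e}. s \<in> e}" by blast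
  then have "colour_degree E c s \<le> colour_degree (E - {?e}) c s"
    unfolding colour_degree_def by (rule card_mono[rotated]) (use finite_E in simp)
  then show False using s colour_degree_ge[OF s(1)] by simp
qed

text \<open>Of three outside vertices, two receive the colour of \<open>{x, z}\<close> from the same
  vertex. If the other cherry repeated this colour too, one of these edges would have its colour
  repeated at both ends.\<close>

lemma twins_colour_neq:
  assumes o: "oriented i x y z" "oriented j x' y' z'" and ne: "i \<noteq> j"
    and t: "twin x y z" "twin x' y' z'" and p: "3 \<le> card (avail {})"
  shows "c {x, z} \<noteq> c {x', z'}"
proof
  assume eq: "c {x, z} = c {x', z'}"
  note f = oriented_facts[OF o(1)] and f' = oriented_facts[OF o(2)]
  obtain S where S: "S \<subseteq> avail {}" "card S = 3" using p by (meson obtain_subset_with_card_n)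
  have "\<forall>w\<in>S. \<exists>u\<in>{x, y}. {u, w} \<in> E \<and> c {u, w} = c {x, z}"
    using t(1) S(1) unfolding twin_def by blast
  then obtain h where h: "\<And>w. w \<in> S \<Longrightarrow> h w \<in> {x, y} \<and> {h w, w} \<in> E \<and> c {h w, w} = c {x, z}"
    by metis
  have "\<not> inj_on h S"
  proof
    assume "inj_on h S"
    moreover have "h ` S \<subseteq> {x, y}" using h by blast
    ultimately have "card S \<le> card {x, y}" by (rule card_inj_on_le) simp
    then show False using S(2) card_edge[OF f(3)] by simp
  qed
  then obtain w w' where w: "w \<in> S" "w' \<in> S" "w \<noteq> w'" "h w = h w'"
    unfolding inj_on_def by blast
  obtain v where v: "v \<in> {x', y'}" "{v, w} \<in> E" "c {v, w} = c {x', z'}"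
    using t(2) S(1) w(1) unfolding twin_def by blast
  have "h w \<noteq> v" using v(1) h[OF w(1)] verts_disjoint[OF f(1) f'(1) ne] f(2) f'(2) by auto
  then show False
    using edge_colour_unique_at_end[of "h w" w w' v] h[OF w(1)] h[OF w(2)] w v eq by auto
qed

text \<open>By \<open>twins_linked\<close> the colours of the good cherries all lie in one tree of the forest, and no two
  of the \<open>2 * card good\<close> colours coincide.\<close>

lemma card_good_le:
  assumes p: "3 \<le> card (avail {})"
  shows "2 * card good \<le> card I + 1"
proof -
  have "\<forall>i\<in>good. \<exists>t. oriented i (fst t) (fst (snd t)) (snd (snd t)) \<and> twin (fst t) (fst (snd t)) (snd (snd t))"
    unfolding good_def by auto
  then obtain h where h: "\<And>i. i \<in> good \<Longrightarrow> oriented i (fst (h i)) (fst (snd (h i))) (snd (snd (h i)))"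
      "\<And>i. i \<in> good \<Longrightarrow> twin (fst (h i)) (fst (snd (h i))) (snd (snd (h i)))"
    by metis
  \<comment> \<open>\<open>h i\<close> is \<open>i\<close> with its leaves ordered so that
    \<open>B i\<close> is the repeated colour.\<close>
  define A where "A i = lcol (h i)" for i
  define B where "B i = rcol (h i)" for i
  have AB: "{lcol i, rcol i} = {A i, B i}" "i \<in> I" "A i \<noteq> B i" if "i \<in> good" for i
    using oriented_facts(1,7,8)[OF h(1)[OF that]] unfolding A_def B_def lcol_def rcol_def by auto
  have edge: "lnk J (A i) (B i)" if "i \<in> good" "i \<in> J" for i J
    using linked_edge[OF that(2), of lcol rcol] AB(1)[OF that(1)] linked_sym by (metis doubleton_eq_iff)
  have cut: "\<not> lnk (I - {i}) (A i) (B i)" if "i \<in> good" for i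
    using forest_I AB(1,2)[OF that] linked_sym unfolding forest_def by (metis doubleton_eq_iff)
  have BB: "lnk (I - {i, j}) (B i) (B j)" "B i \<noteq> B j" if "i \<in> good" "j \<in> good" "i \<noteq> j" for i j
    using twins_linked[OF h(1)[OF that(1)] h(1)[OF that(2)] that(3) h(2)[OF that(1)] h(2)[OF that(2)]]
      twins_colour_neq[OF h(1)[OF that(1)] h(1)[OF that(2)] that(3) h(2)[OF that(1)] h(2)[OF that(2)] p]
    unfolding B_def rcol_def by auto
  have BB': "lnk (I - {i}) (B j) (B i)" if "i \<in> good" "j \<in> good" "i \<noteq> j" for i j
    using linked_sym[OF BB(1)[OF that]] by (rule linked_mono) blast
  have AjBi: "lnk (I - {i}) (A j) (B i)" if "i \<in> good" "j \<in> good" "i \<noteq> j" for i j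
    using linked_trans[OF edge BB'[OF that]] that AB(2) by blast
  \<comment> \<open>\<open>A i\<close> and \<open>B i\<close> are linked only through
    \<open>i\<close>, whereas \<open>A j\<close> and \<open>B j\<close> are linked to
    \<open>B i\<close> without it.\<close>
  have ne: "A i \<noteq> A j" "A i \<noteq> B j" if "i \<in> good" "j \<in> good" "i \<noteq> j" for i j
    using cut[OF that(1)] AjBi[OF that] BB'[OF that] by metis+
  have inj: "inj_on A good" "inj_on B good"
    using ne(1) BB(2) unfolding inj_on_def by blast+
  have disj: "A ` good \<inter> B ` good = {}"
    using ne(2) AB(3) by blast
  have fin: "finite good" using good_subset finite_I finite_subset by blast
  have "card (A ` good \<union> B ` good) = 2 * card good"
    using fin inj disj by (simp add: card_Un_disjoint card_image)
  moreover have "card (A ` good \<union> B ` good) \<le> card I + 1"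
  proof (rule linked_card_le[OF finite_I])
    have ABI: "lnk I (A i) (B j)" if "i \<in> good" "j \<in> good" for i j
    proof (cases "i = j")
      case True then show ?thesis using edge AB(2) that by blast
    next
      case False
      show ?thesis using AjBi[OF that(2,1)] False by (auto intro: linked_mono)
    qed
    have toB: "lnk I f (B j)" if "f \<in> A ` good \<union> B ` good" "j \<in> good" for f j
      using that ABI linked_trans[OF linked_sym[OF ABI] ABI] by blast
    show "lnk I f g" if fg: "f \<in> A ` good \<union> B ` good" "g \<in> A ` good \<union> B ` good" for f g
    proof -
      obtain j where j: "j \<in> good" using fg by blast
      show ?thesis using linked_trans[OF toB[OF fg(1) j] linked_sym[OF toB[OF fg(2) j]]] .
    qed
  qed (use fin in simp)
  ultimately show ?thesis by simp
qed

section \<open>The vertex count\<close>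

lemma few_vertices: "2 * card V < 7 * k + 4"
proof (rule ccontr)
  assume big: "\<not> 2 * card V < 7 * k + 4"
  have "card (\<Union>M) \<le> (\<Sum>e\<in>M. card e)"
    by (rule card_Union_le_sum_card)
  also have "\<dots> = (\<Sum>e\<in>M. 2)"
    by (rule sum.cong[OF refl]) (use card_edge config_facts(4) rainbow_matching_subset_E in blast)
  finally have cM: "card (\<Union>M) \<le> 2 * card M" by simp
  have "card (\<Union>(verts ` I)) \<le> (\<Sum>i\<in>I. card (verts i))"
    using card_UN_le[OF finite_I] by simp
  also have "\<dots> = (\<Sum>i\<in>I. 3)" by (rule sum.cong[OF refl]) (use card_verts in blast)
  finally have cI: "card (\<Union>(verts ` I)) \<le> 3 * card I" by simp
  have "V \<subseteq> avail {} \<union> (U \<union> \<Union>M \<union> \<Union>(verts ` I))" unfolding avail_def by blast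
  moreover have "finite (avail {} \<union> (U \<union> \<Union>M \<union> \<Union>(verts ` I)))"
  proof -
    have "verts i \<subseteq> V" if "i \<in> I" for i
      using verts_avail[OF that subset_refl] unfolding avail_def by blast
    moreover have "\<Union>M \<subseteq> V"
      using rainbow_matching_subset_E[OF config_facts(4)] edge_subset by blast
    ultimately have "U \<union> \<Union>M \<union> \<Union>(verts ` I) \<subseteq> V" using config_facts(1) by blast
    then have "finite (U \<union> \<Union>M \<union> \<Union>(verts ` I))" using finite_vertices finite_subset by blast
    then show ?thesis by simp
  qed
  ultimately have "card V \<le> card (avail {} \<union> (U \<union> \<Union>M \<union> \<Union>(verts ` I)))" by (rule card_mono[rotated])
  also have "\<dots> \<le> card (avail {}) + (card U + card (\<Union>M) + card (\<Union>(verts ` I)))"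
    by (meson add_le_mono card_Un_le order_refl order_trans)
  finally have V: "card V \<le> card (avail {}) + (card U + 2 * card M + 3 * card I)"
    using cM cI by simp
  \<comment> \<open>\<open>7 * k + 4 \<ge> 7 * m + 11\<close>, while twice the occupied vertices is
    at most \<open>7 * card C + 4 * card M + 6 * card I\<close>.\<close>
  then have W: "card I + 11 \<le> 2 * card (avail {})"
    using big config_facts(3,10) m_less by linarith
  then have "3 \<le> card (avail {})" by linarith
  then show False
    using card_avail_le_card_good card_good_le W by fastforce
qed

end

section \<open>Existence of an extremal configuration\<close>

theorem theorem1p1:
  fixes V :: "'a set" and E :: "'a set set" and c :: "'a set \<Rightarrow> 'c" and n k :: nat
  assumes "finite_simple_graph V E"
    and "card V = n"
    and "real n \<ge> 7 * real k / 2 + 2"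
    and "min_colour_degree V E c \<ge> k"
  shows "\<exists>M. matching E M \<and> rainbow c M \<and> card M = k"
proof (rule ccontr)
  assume none: "\<not> ?thesis"
  interpret G: finite_simple_graph V E by (rule assms(1))
  have finV: "finite V" by (rule G.finite_vertices)
  have finE: "finite E"
    using G.edges_wf finV by (metis Pow_iff finite_Pow_iff finite_subset subsetI)
  have deg: "k \<le> colour_degree E c v" if "v \<in> V" for v
  proof -
    have "Min (colour_degree E c ` V) \<le> colour_degree E c v"
      using that finV by simp
    then show ?thesis using assms(4) unfolding min_colour_degree_def by simp
  qed
  \<comment> \<open>A minimal edge set with the bound on colour degrees supplies
    \<open>edge_needed\<close>; its matchings are matchings of \<open>E\<close>.\<close>
  let ?ok = "\<lambda>F. F \<subseteq> E \<and> (\<forall>v\<in>V. k \<le> colour_degree F c v)"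
  define S where "S = {F. ?ok F}"
  have "finite S" "S \<noteq> {}"
    unfolding S_def using finE deg by auto
  then obtain F where "F \<in> S" and min: "\<forall>F'\<in>S. F' \<le> F \<longrightarrow> F = F'"
    using finite_has_minimal[of S] by metis
  then have F: "?ok F" unfolding S_def by simp
  have Fmin: "F = F'" if "?ok F'" "F' \<subseteq> F" for F'
    using min that unfolding S_def by simp
  interpret H: edge_coloured_graph V F c
    by unfold_locales (use F G.edges_wf finV in auto)
  have lt: "card N < k" if "H.rainbow_matching N" for N
  proof (rule ccontr)
    assume "\<not> card N < k"
    then obtain N' where N': "N' \<subseteq> N" "card N' = k"
      by (meson obtain_subset_with_card_n not_less)
    then have "H.rainbow_matching N'" using that H.rainbow_matching_subset by blast
    then have "matching E N'" "rainbow c N'"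
      using F unfolding H.rainbow_matching_def matching_def by auto
    then show False using none N'(2) by blast
  qed
  obtain N where N: "H.rainbow_matching N"
    and Nmax: "\<And>N'. H.rainbow_matching N' \<Longrightarrow> card N' \<le> card N"
    using ex_has_greatest_nat[of H.rainbow_matching "{}" card k] lt H.rainbow_matching_empty
    by (metis less_imp_le)
  define m where "m = card N"
  define P where "P = (\<lambda>(U, C, M, I). H.config m U C M I)"
  \<comment> \<open>A single number encodes the lexicographic order on
    \<open>(card C, card I)\<close>, since \<open>card I \<le> m\<close> in every
    configuration.\<close>
  define weight where "weight = (\<lambda>(U :: 'a set, C :: 'c set, M :: 'a set set, I :: ('a \<times> 'a \<times> 'a) set).
    card C * (m + 1) + card I)"
  have "H.core {} {}" unfolding H.core_def using H.rainbow_matching_empty by fastforce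
  moreover have "H.cherry_forest {}" unfolding H.cherry_forest_def forest_def by simp
  \<comment> \<open>The initial configuration has an empty core, no cherries, and all of
    \<open>N\<close> as its matching.\<close>
  ultimately have start: "P ({}, {}, N, {})"
    unfolding P_def using N by (simp add: H.config_def m_def)
  have "\<forall>q. P q \<longrightarrow> weight q < Suc (m * (m + 1) + m)"
  proof (intro allI impI)
    fix q assume "P q"
    moreover obtain U C M I where q: "q = (U, C, M, I)" by (cases q)
    ultimately have "card C \<le> m" "card I \<le> m" unfolding P_def by (auto simp: H.config_def)
    then show "weight q < Suc (m * (m + 1) + m)"
      unfolding q weight_def by (simp only: prod.case less_Suc_eq_le) (intro add_mono mult_right_mono; simp)
  qed
  from ex_has_greatest_nat[OF start this] obtain q
    where q: "P q" "\<forall>q'. P q' \<longrightarrow> weight q' \<le> weight q" by (elim exE conjE)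
  obtain U C M I where UCMI: "q = (U, C, M, I)" by (cases q)
  have conf: "H.config m U C M I" using q(1) UCMI unfolding P_def by simp
  have max: "card C' * (m + 1) + card I' \<le> card C * (m + 1) + card I"
    if "H.config m U' C' M' I'" for U' C' M' I'
    using q(2)[rule_format, of "(U', C', M', I')"] that UCMI unfolding P_def weight_def by simp
  have "extremal_config V F c k m U C M I"
  proof unfold_locales
    fix U' C' M' I' assume c': "H.config m U' C' M' I'"
    have "card I < m + 1" using conf unfolding H.config_def by linarith
    then have "card C' * (m + 1) < (card C + 1) * (m + 1)"
      using max[OF c'] by simp
    then show "card C' \<le> card C" by (metis Suc_eq_plus1 less_Suc_eq_le mult_less_cancel2)
    show "card I' \<le> card I" if "card C' = card C"
      using max[OF c'] that by simp
  next
    fix e assume e: "e \<in> F"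
    then have "\<not> ?ok (F - {e})" using Fmin[of "F - {e}"] by blast
    then show "\<exists>v\<in>V. colour_degree (F - {e}) c v < k" using F by (meson Diff_subset not_le order_trans)
  next
    show "m < k" using lt[OF N] m_def by simp
  qed (use F Nmax conf in \<open>auto simp: m_def\<close>)
  then have "2 * card V < 7 * k + 4" by (rule extremal_config.few_vertices)
  then show False using assms(2,3) by linarith
qed

end
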